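(* Let $e(x,t)$ be a general polynomial generating function, $e(x,t)=\sum_{n\ge0}b_n(x)\,t^n/n!$ with the $b_n(x)$ polynomials in $x$, and suppose that it satisfies the binomial relation $$e(x,t)\,e(y,t)=e(x+y,t).$$ Let the linear operator $\theta$, acting on the variable $x$, be defined so that $e(x,t)$ is an eigenfunction of it: $$\theta\,e(x,t)=t\,e(x,t).$$ Then $\theta$ commutes with $D$ or, equivalently, with $E$. Explicitly, $\theta E^y e(x,t)=E^y\theta\,e(x,t)$, and by linearity this extends to arbitrary polynomials (or power series), giving the operator statement $\theta E^y=E^y\theta$.
   Context: $D=d/dx$, and $E=e^{D}$ is the unit translation operator, so that $E^y=e^{yD}$ acts by $E^yf(x)=f(x+y)$. Identities involving $t$ are formal power series identities in $t$. The operators $\theta$, $D$ and $E^y$ act on the variable $x$ and coefficientwise in $t$. The result is the converse of the fact that the polynomial sequence attached to an operator $\theta=\phi(D)$, where $\phi(D)$ is a formal power series with $\phi(D)\to D$ as $D\to0$, has an eigenfunction generating function $e(x,t)$ (that is, $\theta e(x,t)=te(x,t)$) satisfying $e(x,t)e(y,t)=e(x+y,t)$. *)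

theory Defs
  imports
    "HOL-Computational_Algebra.Polynomial"
    "HOL-Computational_Algebra.Formal_Power_Series"
begin

text \<open>
  A generating function in \<open>t\<close> whose coefficients are polynomials in \<open>x\<close> is an element of
  \<open>K[x][[t]]\<close>, that is, of the type \<open>'a poly fps\<close>; multiplication by \<open>t\<close> is \<open>(*) fps_X\<close>.
\<close>

definition egf :: "(nat \<Rightarrow> 'a::field_char_0 poly) \<Rightarrow> 'a poly fps" where
  "egf b = Abs_fps (\<lambda>n. smult (1 / fact n) (b n))"

definition eval_at :: "'a::comm_ring_1 \<Rightarrow> 'a poly fps \<Rightarrow> 'a fps" where
  "eval_at x F = Abs_fps (\<lambda>n. poly (fps_nth F n) x)"

definition coeffwise :: "('a::comm_ring_1 poly \<Rightarrow> 'a poly) \<Rightarrow> 'a poly fps \<Rightarrow> 'a poly fps" where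
  "coeffwise T F = Abs_fps (\<lambda>n. T (fps_nth F n))"

definition transl :: "'a::comm_ring_1 \<Rightarrow> 'a poly \<Rightarrow> 'a poly" where
  "transl y p = pcompose p [:y, 1:]"

lemma poly_transl: "poly (transl y p) x = poly p (x + y)"
  by (simp add: transl_def poly_pcompose add.commute)

text \<open>
  Translation by \<open>y\<close> is the operator exponential of \<open>y D\<close>; on a polynomial the exponential
  series is a finite sum.
\<close>

lemma higher_pderiv_pCons:
  fixes p :: "'a::field_char_0 poly"
  shows "(pderiv ^^ Suc k) (pCons a p) =
    pCons 0 ((pderiv ^^ Suc k) p) + smult (of_nat (Suc k)) ((pderiv ^^ k) p)"
proof (induction k)
  case 0
  then show ?case by (simp add: pderiv_pCons)
next
  case (Suc k)
  have "(pderiv ^^ Suc (Suc k)) (pCons a p) = pderiv ((pderiv ^^ Suc k) (pCons a p))"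
    by simp
  also have "\<dots> = pderiv (pCons 0 ((pderiv ^^ Suc k) p) + smult (of_nat (Suc k)) ((pderiv ^^ k) p))"
    using Suc.IH by simp
  also have "\<dots> = (pderiv ^^ Suc k) p + pCons 0 ((pderiv ^^ Suc (Suc k)) p)
      + smult (of_nat (Suc k)) ((pderiv ^^ Suc k) p)"
    by (simp add: pderiv_pCons pderiv_add pderiv_smult)
  also have "\<dots> = pCons 0 ((pderiv ^^ Suc (Suc k)) p)
      + smult (of_nat (Suc (Suc k))) ((pderiv ^^ Suc k) p)"
    unfolding of_nat_Suc[of "Suc k"] smult_add_left by (simp del: funpow.simps of_nat_Suc)
  finally show ?case .
qed

lemma higher_pderiv_eq_0:
  fixes p :: "'a::field_char_0 poly"
  shows "degree p < k \<Longrightarrow> (pderiv ^^ k) p = 0"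
proof (induction k arbitrary: p)
  case 0
  then show ?case by simp
next
  case (Suc k)
  show ?case
  proof (cases "degree p = 0")
    case True
    then have "pderiv p = 0" by (simp add: pderiv_eq_0_iff)
    moreover have "(pderiv ^^ k) (0 :: 'a poly) = 0" by (induction k) auto
    ultimately show ?thesis by (simp add: funpow_swap1 del: funpow.simps add: funpow_Suc_right)
  next
    case False
    then have "degree (pderiv p) < k" using Suc.prems by (simp add: degree_pderiv)
    then show ?thesis using Suc.IH by (simp del: funpow.simps add: funpow_Suc_right)
  qed
qed

lemma transl_eq_exp_pderiv_aux:
  fixes p :: "'a::field_char_0 poly"
  shows "degree p \<le> N \<Longrightarrow>
    transl y p = (\<Sum>k\<le>N. smult (y ^ k / fact k) ((pderiv ^^ k) p))"
proof (induction p arbitrary: N rule: pCons_induct)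
  case 0
  have "(pderiv ^^ k) (0 :: 'a poly) = 0" for k by (induction k) auto
  then show ?case by (simp add: transl_def)
next
  case (pCons a p)
  let ?c = "\<lambda>k. y ^ k / fact k :: 'a"
  let ?D = "\<lambda>k q. (pderiv ^^ k) q :: 'a poly"
  show ?case
  proof (cases "p = 0")
    case True
    have "?D (Suc k) [:a:] = 0" for k by (rule higher_pderiv_eq_0) simp
    then show ?thesis using True
      by (simp add: transl_def sum.atMost_shift del: funpow.simps(2))
  next
    case False
    then obtain M where M: "N = Suc M" "degree p \<le> M"
      using pCons.prems by (cases N) auto
    have IH1: "transl y p = (\<Sum>k\<le>M. smult (?c k) (?D k p))"
      and IH2: "transl y p = (\<Sum>k\<le>N. smult (?c k) (?D k p))"
      by (rule pCons.IH, use M in linarith)+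
    have c: "?c (Suc k) * of_nat (Suc k) = y * ?c k" for k
      by (simp del: of_nat_Suc)
    have sm: "(\<Sum>k\<le>M. smult y (f k)) = smult y (\<Sum>k\<le>M. f k)" for f :: "nat \<Rightarrow> 'a poly"
      by (induction M) (simp_all add: smult_add_right)
    have pC: "pCons 0 q = [:0, 1:] * q" for q :: "'a poly" by simp
    have "(\<Sum>k\<le>N. smult (?c k) (?D k (pCons a p)))
        = pCons a p + (\<Sum>k\<le>M. smult (?c (Suc k)) (?D (Suc k) (pCons a p)))"
      unfolding M(1) sum.atMost_Suc_shift by simp
    also have "\<dots> = pCons a p + (\<Sum>k\<le>M. [:0, 1:] * smult (?c (Suc k)) (?D (Suc k) p)
         + smult y (smult (?c k) (?D k p)))"
      by (simp only: higher_pderiv_pCons smult_add_right smult_smult c pC[of "?D _ p"]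
        mult_smult_right)
    also have "\<dots> = [:a:] + [:0, 1:] * (p + (\<Sum>k\<le>M. smult (?c (Suc k)) (?D (Suc k) p)))
         + smult y (\<Sum>k\<le>M. smult (?c k) (?D k p))"
      unfolding sum.distrib sum_distrib_left[symmetric] sm distrib_left by simp
    also have "p + (\<Sum>k\<le>M. smult (?c (Suc k)) (?D (Suc k) p)) = transl y p"
      unfolding IH2 M(1) sum.atMost_Suc_shift by simp
    also have "(\<Sum>k\<le>M. smult (?c k) (?D k p)) = transl y p"
      by (rule IH1[symmetric])
    also have "[:a:] + [:0, 1:] * transl y p + smult y (transl y p) = transl y (pCons a p)"
      by (simp add: transl_def pcompose_pCons)
    finally show ?thesis ..
  qed
qed

lemma transl_eq_exp_pderiv:
  fixes p :: "'a::field_char_0 poly"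
  shows "transl y p = (\<Sum>k\<le>degree p. smult (y ^ k / fact k) ((pderiv ^^ k) p))"
  by (rule transl_eq_exp_pderiv_aux) simp

end

theory Submission
  imports Defs
begin

text \<open>
  Write \<open>c n\<close> for the coefficient of \<open>t ^ n\<close> in the generating function. The binomial relation says
  that \<open>E\<^sup>y c\<^sub>n = (\<Sum>k\<le>n. c\<^sub>n\<^sub>-\<^sub>k(y) c\<^sub>k)\<close> and the eigenvalue relation says that \<open>\<theta>\<close> lowers the index by
  one, so \<open>\<theta>\<close> and \<open>E\<^sup>y\<close> commute on every \<open>c\<^sub>n\<close>. Differentiating the binomial relation at \<open>y = 0\<close> gives
  \<open>D c\<^sub>n = (\<Sum>k<n. c'\<^sub>n\<^sub>-\<^sub>k(0) c\<^sub>k)\<close>, where \<open>c'\<^sub>1(0)\<close> is nonzero because \<open>\<theta> c\<^sub>1 = c\<^sub>0 = 1\<close>. Hence \<open>c\<^sub>n\<close> has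
  degree exactly \<open>n\<close>, and the \<open>c\<^sub>n\<close> span all polynomials. A linear operator commuting with \<open>E\<close> commutes
  with \<open>E\<^sup>m\<close> for all natural \<open>m\<close>; the Taylor expansion of \<open>E\<^sup>y\<close> is polynomial in \<open>y\<close>, so its
  coefficients, in particular that of \<open>D\<close>, can be compared.
\<close>

lemma transl_add: "transl y (p + q) = transl y p + transl y q"
  by (simp add: transl_def pcompose_add)

lemma transl_smult: "transl y (smult a p) = smult a (transl y p)"
  by (simp add: transl_def pcompose_smult)

lemma transl_0: "transl y 0 = 0"
  by (simp add: transl_def)

lemma transl_1_funpow:
  fixes p :: "'a::field_char_0 poly"
  shows "(transl 1 ^^ m) p = transl (of_nat m) p"
proof (induction m)
  case 0
  then show ?case by (simp add: transl_def)
next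
  case (Suc m)
  then show ?case
    by (intro iffD1[OF poly_eq_poly_eq_iff], intro ext)
       (simp add: poly_transl add_ac)
qed

lemma funpow_commute:
  assumes "T \<circ> S = S \<circ> T"
  shows "T ((S ^^ k) x) = (S ^^ k) (T x)"
  using assms by (induction k) (simp_all add: fun_eq_iff)

lemma poly_operator_add:
  assumes "Vector_Spaces.linear smult smult T"
  shows "T (p + q) = T p + T q"
  by (rule module_hom.add[OF Vector_Spaces.linear.axioms(3)[OF assms]])

lemma poly_operator_smult:
  assumes "Vector_Spaces.linear smult smult T"
  shows "T (smult a p) = smult a (T p)"
  using assms by (simp add: Vector_Spaces.linear_def module_hom.scale)

lemma poly_operator_0:
  assumes "Vector_Spaces.linear smult smult T"
  shows "T 0 = 0"
  by (rule module_hom.zero[OF Vector_Spaces.linear.axioms(3)[OF assms]])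

lemma poly_operator_sum:
  assumes "Vector_Spaces.linear smult smult T"
  shows "T (\<Sum>i\<in>A. f i) = (\<Sum>i\<in>A. T (f i))"
  by (rule module_hom.sum[OF Vector_Spaces.linear.axioms(3)[OF assms]])

lemma poly_operator_transl:
  fixes T :: "'a::field_char_0 poly \<Rightarrow> 'a poly"
  assumes lin: "Vector_Spaces.linear smult smult T" and "degree p \<le> N"
  shows "T (transl y p) = (\<Sum>k\<le>N. smult (y ^ k / fact k) (T ((pderiv ^^ k) p)))"
  unfolding transl_eq_exp_pderiv_aux[OF assms(2)] poly_operator_sum[OF lin]
    poly_operator_smult[OF lin] ..

lemma commute_pderiv_imp_commute_transl:
  fixes T :: "'a::field_char_0 poly \<Rightarrow> 'a poly"
  assumes lin: "Vector_Spaces.linear smult smult T" and "T \<circ> pderiv = pderiv \<circ> T"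
  shows "T \<circ> transl y = transl y \<circ> T"
proof
  fix p
  \<comment> \<open>A common bound on both degrees lets the two finite Taylor sums run over the same
    range.\<close>
  define N where "N = max (degree p) (degree (T p))"
  have "T (transl y p) = (\<Sum>k\<le>N. smult (y ^ k / fact k) (T ((pderiv ^^ k) p)))"
    by (rule poly_operator_transl[OF lin]) (simp add: N_def)
  also have "\<dots> = transl y (T p)"
    by (subst transl_eq_exp_pderiv_aux[of "T p" N])
       (simp_all add: N_def funpow_commute[OF assms(2)])
  finally show "(T \<circ> transl y) p = (transl y \<circ> T) p" by simp
qed

lemma commute_transl_imp_commute_pderiv:
  fixes T :: "'a::field_char_0 poly \<Rightarrow> 'a poly"
  assumes lin: "Vector_Spaces.linear smult smult T" and comm: "T \<circ> transl 1 = transl 1 \<circ> T"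
  shows "T \<circ> pderiv = pderiv \<circ> T"
proof
  fix p
  \<comment> \<open>The \<open>Suc\<close> guarantees that the first-order term is in the range,
    even when both polynomials are constant.\<close>
  define N where "N = Suc (max (degree p) (degree (T p)))"
  then have N: "degree p \<le> N" "degree (T p) \<le> N" "1 \<le> N" by auto
  define d where "d k = T ((pderiv ^^ k) p) - (pderiv ^^ k) (T p)" for k
  have "poly (d 1) x = 0" for x
  proof -
    \<comment> \<open>With \<open>x\<close> fixed, \<open>q\<close> is the difference of the two
      Taylor expansions as a polynomial in the translation amount. It vanishes at every natural
      number, hence identically, since these are infinitely many points in characteristic 0.\<close>
    define q where "q = (\<Sum>k\<le>N. monom (poly (d k) x / fact k) k)"
    have "poly q (of_nat m) = 0" for m
    proof -
      have "T (transl (of_nat m) p) = transl (of_nat m) (T p)"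
        using funpow_commute[OF comm, of m p] by (simp add: transl_1_funpow)
      moreover have "T (transl (of_nat m) p)
          = (\<Sum>k\<le>N. smult (of_nat m ^ k / fact k) (T ((pderiv ^^ k) p)))"
        by (rule poly_operator_transl[OF lin N(1)])
      moreover have "transl (of_nat m) (T p)
          = (\<Sum>k\<le>N. smult (of_nat m ^ k / fact k) ((pderiv ^^ k) (T p)))"
        by (rule transl_eq_exp_pderiv_aux[OF N(2)])
      ultimately have "(\<Sum>k\<le>N. smult (of_nat m ^ k / fact k) (d k)) = 0"
        by (simp add: d_def smult_diff_right sum_subtractf)
      then have "poly (\<Sum>k\<le>N. smult (of_nat m ^ k / fact k) (d k)) x = 0" by simp
      then show ?thesis by (simp add: q_def poly_sum poly_monom mult.commute)
    qed
    then have "range (of_nat :: nat \<Rightarrow> 'a) \<subseteq> {z. poly q z = 0}" by auto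
    then have "infinite {z. poly q z = 0}"
      using infinite_super range_inj_infinite[OF inj_of_nat] by blast
    then have "q = 0" using poly_roots_finite by blast
    moreover have "coeff q 1 = poly (d 1) x"
      using N(3) by (simp add: q_def coeff_sum)
    ultimately show ?thesis by simp
  qed
  then have "d 1 = 0" using poly_all_0_iff_0 by blast
  then show "(T \<circ> pderiv) p = (pderiv \<circ> T) p" by (simp add: d_def)
qed

text \<open>Subtracting a multiple of \<open>c n\<close>, where \<open>n\<close> is the degree of
  \<open>p\<close>, cancels the leading term. The zero polynomial also has degree 0, so
  \<open>c 0\<close> must be assumed nonzero separately.\<close>

lemma poly_basis_induct:
  fixes c :: "nat \<Rightarrow> 'a::field poly"
  assumes deg: "\<And>n. degree (c n) = n" and c0: "c 0 \<noteq> 0"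
    and P0: "P 0"
    and step: "\<And>p a n. P p \<Longrightarrow> P (p + smult a (c n))"
  shows "P p"
proof (induction "degree p" arbitrary: p rule: less_induct)
  case less
  define n where "n = degree p"
  define q where "q = p - smult (lead_coeff p / lead_coeff (c n)) (c n)"
  have "c n \<noteq> 0" using c0 deg[of n] by (cases n) auto
  then have lc: "lead_coeff (c n) \<noteq> 0" by simp
  have le: "degree q \<le> n" unfolding q_def
    by (intro degree_diff_le) (simp_all add: n_def deg order_trans[OF degree_smult_le])
  have top: "coeff q n = 0" using lc by (simp add: q_def deg) (simp add: n_def)
  have "P q"
  proof (cases "q = 0")
    case False
    then have "degree q < n" using le top by (metis leading_coeff_0_iff le_neq_implies_less)
    then show ?thesis using less n_def by blast
  qed (simp add: P0)
  from step[OF this] show "P p" by (metis q_def diff_add_cancel)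
qed

context
  fixes c :: "nat \<Rightarrow> 'a::field_char_0 poly"
  assumes binomial: "\<And>n x y. poly (c n) (x + y) = (\<Sum>k\<le>n. poly (c k) x * poly (c (n - k)) y)"
begin

lemma transl_binomial: "transl y (c n) = (\<Sum>k\<le>n. smult (poly (c (n - k)) y) (c k))"
  by (rule poly_eq_poly_eq_iff[THEN iffD1], rule ext)
     (simp add: poly_transl binomial poly_sum mult.commute)

lemma pderiv_binomial:
  "pderiv (c n) = (\<Sum>k\<le>n. smult (poly (pderiv (c (n - k))) 0) (c k))"
proof (rule poly_eq_poly_eq_iff[THEN iffD1], rule ext)
  fix x
  \<comment> \<open>Here \<open>x\<close> enters only through the scalars, so differentiating in the
    other variable at 0 acts on \<open>c (n - k)\<close> alone.\<close>
  have "transl x (c n) = (\<Sum>k\<le>n. smult (poly (c k) x) (c (n - k)))"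
    by (rule poly_eq_poly_eq_iff[THEN iffD1], rule ext)
       (simp add: poly_transl poly_sum binomial[symmetric] add.commute)
  then have "poly (pderiv (transl x (c n))) 0
      = poly (pderiv (\<Sum>k\<le>n. smult (poly (c k) x) (c (n - k)))) 0" by simp
  then show "poly (pderiv (c n)) x
      = poly (\<Sum>k\<le>n. smult (poly (pderiv (c (n - k))) 0) (c k)) x"
    by (simp add: transl_def pderiv_pcompose pderiv_pCons poly_pcompose
        higher_pderiv_sum[of 1, simplified] pderiv_smult poly_sum mult.commute)
qed

text \<open>The derivative of \<open>c 0\<close> is a scalar multiple of \<open>c 0\<close>, whereas
  differentiation strictly lowers the degree of a nonconstant polynomial in characteristic
  0.\<close>

lemma binomial_coeff_0:
  assumes "poly (c 0) 0 = 1"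
  shows "c 0 = 1"
proof -
  have d: "pderiv (c 0) = smult (poly (pderiv (c 0)) 0) (c 0)"
    using pderiv_binomial[of 0] by simp
  then have "degree (pderiv (c 0)) = degree (c 0) \<or> pderiv (c 0) = 0"
    by (metis degree_smult_eq smult_0_left)
  then have "degree (c 0) = 0" by (auto simp: degree_pderiv pderiv_eq_0_iff)
  then obtain a where "c 0 = [:a:]" by (rule degree_eq_zeroE)
  with assms show ?thesis by (simp add: one_pCons)
qed

text \<open>In \<open>pderiv_binomial\<close> the term \<open>k = n\<close> drops out because
  \<open>c 0\<close> is constant. What remains is led by a nonzero multiple of
  \<open>c (n - 1)\<close>, which fixes the degree of the derivative.\<close>

lemma degree_binomial:
  assumes c0: "c 0 = 1" and c1: "degree (c 1) \<noteq> 0"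
  shows "degree (c n) = n"
proof (induction n rule: less_induct)
  case (less n)
  show ?case
  proof (cases n)
    case 0
    then show ?thesis by (simp add: c0)
  next
    case (Suc m)
    define a where "a j = poly (pderiv (c j)) 0" for j
    have a0: "a 0 = 0" by (simp add: a_def c0)
    have "pderiv (c 1) = [:a 1:]"
      using pderiv_binomial[of 1] by (simp add: c0 a_def)
    with c1 have a1: "a 1 \<noteq> 0" by (auto simp: pderiv_eq_0_iff)
    have cm: "degree (c m) = m" using less Suc by simp
    have cm0: "c m \<noteq> 0" using cm c0 by (cases m) auto
    have eq: "pderiv (c n) = (\<Sum>k<m. smult (a (n - k)) (c k)) + smult (a 1) (c m)"
      using pderiv_binomial[of n] a0
      by (simp add: Suc a_def lessThan_Suc_atMost[symmetric])
    have le: "degree (\<Sum>k<m. smult (a (n - k)) (c k)) \<le> m"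
      by (rule degree_sum_le) (use less Suc in \<open>auto intro: order_trans[OF degree_smult_le]\<close>)
    have "coeff (c k) m = 0" if "k < m" for k
      using less[of k] Suc that by (simp add: coeff_eq_0)
    then have "coeff (pderiv (c n)) m = a 1 * lead_coeff (c m)"
      unfolding eq by (simp add: coeff_sum cm)
    then have "coeff (pderiv (c n)) m \<noteq> 0" using a1 cm0 by simp
    then have ge: "m \<le> degree (pderiv (c n))" and nz: "pderiv (c n) \<noteq> 0"
      by (auto intro: le_degree)
    have "degree (pderiv (c n)) \<le> m"
      unfolding eq by (intro degree_add_le le) (simp add: cm order_trans[OF degree_smult_le])
    with ge nz show ?thesis by (simp add: degree_pderiv pderiv_eq_0_iff Suc)
  qed
qed

lemma lowering_commute_transl:
  assumes lin: "Vector_Spaces.linear smult smult T"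
    and c0: "c 0 = 1" and c1: "degree (c 1) \<noteq> 0"
    and T0: "T (c 0) = 0" and TSuc: "\<And>n. T (c (Suc n)) = c n"
  shows "T \<circ> transl y = transl y \<circ> T"
proof
  fix p
  note T_simps = poly_operator_add[OF lin] poly_operator_smult[OF lin] poly_operator_0[OF lin]
    poly_operator_sum[OF lin]
  have basis: "T (transl y (c n)) = transl y (T (c n))" for n
  proof (cases n)
    case 0
    then show ?thesis by (simp add: transl_binomial T_simps T0 transl_0)
  next
    case (Suc m)
    have "T (transl y (c n)) = (\<Sum>k\<le>n. smult (poly (c (n - k)) y) (T (c k)))"
      by (simp add: transl_binomial T_simps)
    \<comment> \<open>\<open>T\<close> kills the term \<open>k = 0\<close>, and shifting the index
      turns \<open>n - Suc k\<close> into \<open>m - k\<close>.\<close>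
    also have "\<dots> = (\<Sum>k\<le>m. smult (poly (c (m - k)) y) (c k))"
      unfolding Suc sum.atMost_Suc_shift by (simp add: T0 TSuc)
    finally show ?thesis by (simp add: Suc TSuc transl_binomial)
  qed
  have "T (transl y p) = transl y (T p)"
  proof (rule poly_basis_induct[of c "\<lambda>p. T (transl y p) = transl y (T p)"])
    show "degree (c n) = n" for n by (rule degree_binomial[OF c0 c1])
  qed (simp_all add: c0 T_simps transl_0 transl_add transl_smult basis)
  then show "(T \<circ> transl y) p = (transl y \<circ> T) p" by simp
qed

end

lemma eval_at_eq_0_imp:
  fixes F :: "'a::field_char_0 poly fps"
  assumes "\<And>x. eval_at x F = 0"
  shows "F = 0"
proof (rule fps_ext)
  fix n
  have "poly (fps_nth F n) x = 0" for x
    using arg_cong[OF assms[of x], of "\<lambda>G. fps_nth G n"] by (simp add: eval_at_def)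
  then show "fps_nth F n = fps_nth 0 n" using poly_all_0_iff_0 by auto
qed

theorem mainTheorem6:
  fixes b :: "nat \<Rightarrow> 'a::field_char_0 poly"
    and \<theta> :: "'a poly \<Rightarrow> 'a poly"
  assumes nonzero: "egf b \<noteq> 0"
    and binomial: "\<And>x y. eval_at x (egf b) * eval_at y (egf b) = eval_at (x + y) (egf b)"
    and linear: "Vector_Spaces.linear smult smult \<theta>"
    and eigen: "coeffwise \<theta> (egf b) = fps_X * egf b"
  shows "\<theta> \<circ> pderiv = pderiv \<circ> \<theta>
    \<and> \<theta> \<circ> transl 1 = transl 1 \<circ> \<theta>
    \<and> (\<forall>T :: 'a poly \<Rightarrow> 'a poly. Vector_Spaces.linear smult smult T \<longrightarrow>
         (T \<circ> pderiv = pderiv \<circ> T \<longleftrightarrow> T \<circ> transl 1 = transl 1 \<circ> T))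
    \<and> (\<forall>y. coeffwise \<theta> (coeffwise (transl y) (egf b)) = coeffwise (transl y) (coeffwise \<theta> (egf b)))
    \<and> (\<forall>y. \<theta> \<circ> transl y = transl y \<circ> \<theta>)
    \<and> (\<forall>y F. coeffwise \<theta> (coeffwise (transl y) F) = coeffwise (transl y) (coeffwise \<theta> F))"
proof -
  define c where "c = fps_nth (egf b)"
  have bin: "poly (c n) (x + y) = (\<Sum>k\<le>n. poly (c k) x * poly (c (n - k)) y)" for n x y
    using arg_cong[OF binomial[of x y], of "\<lambda>G. fps_nth G n"]
    by (simp add: eval_at_def c_def fps_mult_nth atLeast0AtMost)
  \<comment> \<open>The series at 0 is a factor of the series at every \<open>x\<close>; being
    idempotent and nonzero in an integral domain, it equals 1.\<close>
  have "eval_at 0 (egf b) \<noteq> 0"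
  proof
    assume "eval_at 0 (egf b) = 0"
    then have "eval_at x (egf b) = 0" for x using binomial[of x 0] by simp
    with nonzero show False using eval_at_eq_0_imp by blast
  qed
  then have one: "eval_at 0 (egf b) = 1" using binomial[of 0 0] by simp
  have at0: "poly (c n) 0 = (if n = 0 then 1 else 0)" for n
    using arg_cong[OF one, of "\<lambda>G. fps_nth G n"] by (simp add: eval_at_def c_def)
  have c0: "c 0 = 1" by (rule binomial_coeff_0[OF bin]) (simp add: at0)
  have \<theta>: "\<theta> (c n) = (if n = 0 then 0 else c (n - 1))" for n
    using arg_cong[OF eigen, of "\<lambda>G. fps_nth G n"] by (simp add: coeffwise_def c_def)
  \<comment> \<open>A constant \<open>c 1\<close> would be 0, as it vanishes at 0; but
    \<open>\<theta>\<close> sends \<open>c 1\<close> to 1.\<close>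
  have "degree (c 1) \<noteq> 0"
  proof
    assume "degree (c 1) = 0"
    then obtain a where "c 1 = [:a:]" by (rule degree_eq_zeroE)
    with at0[of 1] have "c 1 = 0" by simp
    with \<theta>[of 1] show False by (simp add: c0 poly_operator_0[OF linear])
  qed
  then have comm: "\<theta> \<circ> transl y = transl y \<circ> \<theta>" for y
    by (intro lowering_commute_transl[OF bin linear c0]) (simp_all add: \<theta>)
  then have comm_coeffwise: "coeffwise \<theta> (coeffwise (transl y) F) = coeffwise (transl y) (coeffwise \<theta> F)"
    for y F
    by (simp add: coeffwise_def fun_eq_iff)
  show ?thesis
    using comm comm_coeffwise commute_pderiv_imp_commute_transl commute_transl_imp_commute_pderiv linear
    by blast
qed

end
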